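(* Let $\Delta$ be a semiregular right-angled building over $I$ and let $\lambda$ be a legal colouring of $\Delta$ using the colour sets $X_i$ (for $i\in I$). For every $i\in I$, consider an equivalence relation $\equiv_i$ on $X_i$, write $[x]_i$ for the class of $x\in X_i$, and let $I'=\{i\in I\mid \equiv_i\text{ is not the universal relation}\}$. Let $\Delta'$ be the semiregular right-angled building over $I'$ whose diagram is induced by the diagram of $\Delta$ and with parameters $q_i'=|X_i/{\equiv_i}|$ (for every $i\in I'$). Equip $\Delta'$ with a legal colouring $\lambda'$ using the quotient set $X_i/{\equiv_i}$ as the set of $i$-colours for $i\in I'$. Then there exists a surjective map $\tau:\Delta\to\Delta'$ (between the sets of chambers) such that $\lambda_i'(\tau(c))=[\lambda_i(c)]_i$ for all chambers $c\in\Delta$ and all $i\in I'$, and such that $\mathrm{dist}_{\Delta'}(\tau(c_1),\tau(c_2))\le\mathrm{dist}_\Delta(c_1,c_2)$ for all $c_1,c_2\in\Delta$.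
   Context: Let $I$ be a finite set and $M=(m_{ij})_{i,j\in I}$ a right-angled Coxeter matrix: $m_{ii}=1$ and $m_{ij}=m_{ji}\in\{2,\infty\}$ for $i\ne j$; let $W$ be the Coxeter group with generators $(s_i)_{i\in I}$. The diagram is the graph on $I$ in which $i,j$ are joined iff $m_{ij}=\infty$. A (right-angled) building $\Delta$ of type $M$ (over $I$) is viewed as a chamber system: a set of chambers with an equivalence relation $\sim_i$ ($i$-adjacency) for each $i\in I$, all classes having at least two elements, and a map $\delta:\Delta\times\Delta\to W$ such that for each reduced word $s_{i_1}\cdots s_{i_k}$, $\delta(c,d)=s_{i_1}\cdots s_{i_k}$ iff there is a gallery $c=c_0\sim_{i_1}c_1\sim_{i_2}\cdots\sim_{i_k}c_k=d$ (consecutive chambers distinct) of type $(i_1,\dots,i_k)$. An $i$-panel is an equivalence class of $\sim_i$. $\mathrm{dist}_\Delta(c,d)$ is the length of a shortest gallery from $c$ to $d$. $\Delta$ is semiregular with parameters $(q_i)_{i\in I}$ if every $i$-panel has the same (possibly infinite) cardinality $q_i\ge 2$; for any choice of cardinals $q_i\ge2$ such a building exists and is unique up to isomorphism (for an empty index set it is a single chamber). Given sets $X_i$ with $|X_i|=q_i$, a legal colouring is a map $\lambda=(\lambda_i)_{i\in I}:\Delta\to\prod_{i\in I}X_i$ such that for every $i$-panel $\mathcal P$, $\lambda_i|_{\mathcal P}:\mathcal P\to X_i$ is a bijection and $\lambda_j|_{\mathcal P}$ is constant for all $j\ne i$. *)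

theory Defs
  imports
    "HOL-Algebra.Group"
    "HOL-Library.Extended_Nat"
    "HOL-Library.Equipollence"
begin

section \<open>Right-angled Coxeter groups\<close>

locale right_angled_coxeter_matrix =
  fixes I :: "'i set" and M :: "'i \<Rightarrow> 'i \<Rightarrow> enat"
  assumes finite_index: "finite I"
    and diag: "i \<in> I \<Longrightarrow> M i i = 1"
    and symm: "i \<in> I \<Longrightarrow> j \<in> I \<Longrightarrow> M i j = M j i"
    and right_angled: "i \<in> I \<Longrightarrow> j \<in> I \<Longrightarrow> i \<noteq> j \<Longrightarrow> M i j \<in> {2, \<infinity>}"

definition coxeter_diagram :: "'i set \<Rightarrow> ('i \<Rightarrow> 'i \<Rightarrow> enat) \<Rightarrow> ('i \<times> 'i) set" where
  "coxeter_diagram I M = {(i, j). i \<in> I \<and> j \<in> I \<and> i \<noteq> j \<and> M i j = \<infinity>}"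

text \<open>The Coxeter group is presented as a quotient of the free monoid of words over \<open>I\<close> by the
  congruence generated by the relations \<open>(s\<^sub>i s\<^sub>j)^(M i j) = 1\<close> with \<open>M i j\<close> finite. Since
  \<open>M i i = 1\<close> makes every generator its own inverse, this monoid is the group with the same
  presentation (see \<open>group_coxeter_group\<close> below).\<close>

inductive coxeter_cong :: "'i set \<Rightarrow> ('i \<Rightarrow> 'i \<Rightarrow> enat) \<Rightarrow> 'i list \<Rightarrow> 'i list \<Rightarrow> bool"
  for I M where
  relator: "u \<in> lists I \<Longrightarrow> v \<in> lists I \<Longrightarrow> i \<in> I \<Longrightarrow> j \<in> I \<Longrightarrow> M i j = enat k \<Longrightarrow>
    coxeter_cong I M (u @ concat (replicate k [i, j]) @ v) (u @ v)"
| refl: "u \<in> lists I \<Longrightarrow> coxeter_cong I M u u"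
| sym: "coxeter_cong I M u v \<Longrightarrow> coxeter_cong I M v u"
| trans: "coxeter_cong I M u v \<Longrightarrow> coxeter_cong I M v w \<Longrightarrow> coxeter_cong I M u w"

text \<open>The element \<open>s\<^sub>i\<^sub>1 \<cdots> s\<^sub>i\<^sub>k\<close> of the Coxeter group represented by the word \<open>[i\<^sub>1, \<dots>, i\<^sub>k]\<close>.\<close>

definition word_elem :: "'i set \<Rightarrow> ('i \<Rightarrow> 'i \<Rightarrow> enat) \<Rightarrow> 'i list \<Rightarrow> 'i list set" where
  "word_elem I M w = {v. coxeter_cong I M w v}"

definition coxeter_group :: "'i set \<Rightarrow> ('i \<Rightarrow> 'i \<Rightarrow> enat) \<Rightarrow> 'i list set monoid" where
  "coxeter_group I M =
     \<lparr>carrier = word_elem I M ` lists I,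
      mult = (\<lambda>A B. \<Union>u\<in>A. \<Union>v\<in>B. word_elem I M (u @ v)),
      one = word_elem I M []\<rparr>"

definition reduced_word :: "'i set \<Rightarrow> ('i \<Rightarrow> 'i \<Rightarrow> enat) \<Rightarrow> 'i list \<Rightarrow> bool" where
  "reduced_word I M w \<longleftrightarrow>
     w \<in> lists I \<and> (\<forall>v \<in> lists I. word_elem I M v = word_elem I M w \<longrightarrow> length w \<le> length v)"

lemma concat_replicate_in_lists:
  "i \<in> I \<Longrightarrow> j \<in> I \<Longrightarrow> concat (replicate k [i, j]) \<in> lists I"
  by (induction k) auto

lemma coxeter_cong_lists:
  "coxeter_cong I M u v \<Longrightarrow> u \<in> lists I \<and> v \<in> lists I"
proof (induction rule: coxeter_cong.induct)
  case (relator u v i j k)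
  then show ?case
    using concat_replicate_in_lists[of i I j k] by (auto simp del: set_concat)
qed auto

lemma coxeter_cong_append_left:
  "coxeter_cong I M u v \<Longrightarrow> w \<in> lists I \<Longrightarrow> coxeter_cong I M (w @ u) (w @ v)"
proof (induction rule: coxeter_cong.induct)
  case (relator u v i j k)
  have "w @ u \<in> lists I" using relator by simp
  from coxeter_cong.relator[of "w @ u" I v i j M k, OF this relator(2-5)]
  show ?case by simp
next
  case (refl u)
  then show ?case by (intro coxeter_cong.refl) simp
next
  case (sym u v)
  then show ?case by (simp add: coxeter_cong.sym)
next
  case (trans u v x)
  then show ?case by (metis coxeter_cong.trans)
qed

lemma coxeter_cong_append_right:
  "coxeter_cong I M u v \<Longrightarrow> w \<in> lists I \<Longrightarrow> coxeter_cong I M (u @ w) (v @ w)"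
proof (induction rule: coxeter_cong.induct)
  case (relator u v i j k)
  have "v @ w \<in> lists I" using relator by simp
  from coxeter_cong.relator[of u I "v @ w" i j M k, OF relator(1) this relator(3-5)]
  show ?case by simp
next
  case (refl u)
  then show ?case by (intro coxeter_cong.refl) simp
next
  case (sym u v)
  then show ?case by (simp add: coxeter_cong.sym)
next
  case (trans u v x)
  then show ?case by (metis coxeter_cong.trans)
qed

lemma word_elem_eq_iff:
  "u \<in> lists I \<Longrightarrow> word_elem I M u = word_elem I M v \<longleftrightarrow> coxeter_cong I M u v"
  unfolding word_elem_def set_eq_iff mem_Collect_eq
  by (metis coxeter_cong.refl coxeter_cong.sym coxeter_cong.trans)

lemma word_elem_mult:
  assumes "u \<in> lists I" "v \<in> lists I"
  shows "word_elem I M u \<otimes>\<^bsub>coxeter_group I M\<^esub> word_elem I M v = word_elem I M (u @ v)"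
proof -
  have "word_elem I M (u' @ v') = word_elem I M (u @ v)"
    if "u' \<in> word_elem I M u" "v' \<in> word_elem I M v" for u' v'
  proof -
    have *: "coxeter_cong I M u u'" "coxeter_cong I M v v'"
      using that by (auto simp: word_elem_def)
    have "coxeter_cong I M (u @ v) (u' @ v')"
      using coxeter_cong.trans[OF coxeter_cong_append_right[OF *(1) assms(2)]
          coxeter_cong_append_left[OF *(2)]] coxeter_cong_lists[OF *(1)]
      by simp
    then show ?thesis
      using assms by (metis append_in_lists_conv word_elem_eq_iff)
  qed
  moreover have "u \<in> word_elem I M u" "v \<in> word_elem I M v"
    using assms by (auto simp: word_elem_def intro: coxeter_cong.refl)
  ultimately have "(\<Union>u'\<in>word_elem I M u. \<Union>v'\<in>word_elem I M v. word_elem I M (u' @ v'))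
      = word_elem I M (u @ v)"
    by blast
  then show ?thesis
    by (simp add: coxeter_group_def)
qed

context right_angled_coxeter_matrix
begin

lemma coxeter_cong_rev: "w \<in> lists I \<Longrightarrow> coxeter_cong I M (rev w @ w) []"
proof (induction w)
  case Nil
  then show ?case by (simp add: coxeter_cong.refl)
next
  case (Cons i w)
  then have "i \<in> I" "w \<in> lists I" "rev w \<in> lists I" by (auto simp: in_lists_conv_set)
  moreover have "M i i = enat 1" using diag[OF \<open>i \<in> I\<close>] by (simp add: one_enat_def)
  ultimately have "coxeter_cong I M (rev w @ concat (replicate 1 [i, i]) @ w) (rev w @ w)"
    by (intro coxeter_cong.relator)
  moreover have "coxeter_cong I M (rev w @ w) []" using Cons by simp
  ultimately have "coxeter_cong I M (rev w @ concat (replicate 1 [i, i]) @ w) []"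
    by (rule coxeter_cong.trans)
  then show ?case by simp
qed

lemma group_coxeter_group: "group (coxeter_group I M)"
proof (rule groupI)
  fix x assume "x \<in> carrier (coxeter_group I M)"
  then obtain w where w: "w \<in> lists I" "x = word_elem I M w"
    by (auto simp: coxeter_group_def)
  then have "rev w \<in> lists I" by (auto simp: in_lists_conv_set)
  moreover have "word_elem I M (rev w @ w) = word_elem I M []"
    using coxeter_cong_rev[OF w(1)] w(1) calculation by (subst word_elem_eq_iff) auto
  ultimately have "word_elem I M (rev w) \<otimes>\<^bsub>coxeter_group I M\<^esub> x = \<one>\<^bsub>coxeter_group I M\<^esub>"
    using w by (simp add: word_elem_mult) (simp add: coxeter_group_def)
  with \<open>rev w \<in> lists I\<close>
  show "\<exists>y\<in>carrier (coxeter_group I M). y \<otimes>\<^bsub>coxeter_group I M\<^esub> x = \<one>\<^bsub>coxeter_group I M\<^esub>"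
    by (auto simp: coxeter_group_def)
next
  fix x assume "x \<in> carrier (coxeter_group I M)"
  then obtain w where w: "w \<in> lists I" "x = word_elem I M w"
    by (auto simp: coxeter_group_def)
  have "\<one>\<^bsub>coxeter_group I M\<^esub> = word_elem I M []" by (simp add: coxeter_group_def)
  then show "\<one>\<^bsub>coxeter_group I M\<^esub> \<otimes>\<^bsub>coxeter_group I M\<^esub> x = x"
    using w by (simp add: word_elem_mult)
next
  fix x y assume "x \<in> carrier (coxeter_group I M)" "y \<in> carrier (coxeter_group I M)"
  then obtain u v where "u \<in> lists I" "x = word_elem I M u" "v \<in> lists I" "y = word_elem I M v"
    by (auto simp: coxeter_group_def)
  then have "x \<otimes>\<^bsub>coxeter_group I M\<^esub> y = word_elem I M (u @ v)" "u @ v \<in> lists I"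
    by (simp_all add: word_elem_mult)
  then show "x \<otimes>\<^bsub>coxeter_group I M\<^esub> y \<in> carrier (coxeter_group I M)"
    by (simp add: coxeter_group_def)
next
  fix x y z
  assume "x \<in> carrier (coxeter_group I M)" "y \<in> carrier (coxeter_group I M)"
    "z \<in> carrier (coxeter_group I M)"
  then obtain u v w where "u \<in> lists I" "x = word_elem I M u" "v \<in> lists I" "y = word_elem I M v"
    "w \<in> lists I" "z = word_elem I M w"
    by (auto simp: coxeter_group_def)
  then show "x \<otimes>\<^bsub>coxeter_group I M\<^esub> y \<otimes>\<^bsub>coxeter_group I M\<^esub> z
      = x \<otimes>\<^bsub>coxeter_group I M\<^esub> (y \<otimes>\<^bsub>coxeter_group I M\<^esub> z)"
    by (simp add: word_elem_mult)
qed (auto simp: coxeter_group_def)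

end


section \<open>Right-angled buildings as chamber systems\<close>

text \<open>\<open>gallery adj c w d\<close>: there is a gallery of type \<open>w\<close> from \<open>c\<close> to \<open>d\<close>, with consecutive
  chambers distinct.\<close>

primrec gallery :: "('i \<Rightarrow> ('c \<times> 'c) set) \<Rightarrow> 'c \<Rightarrow> 'i list \<Rightarrow> 'c \<Rightarrow> bool" where
  "gallery adj c [] d \<longleftrightarrow> c = d"
| "gallery adj c (i # w) d \<longleftrightarrow> (\<exists>e. (c, e) \<in> adj i \<and> c \<noteq> e \<and> gallery adj e w d)"

text \<open>The chamber set is required to be nonempty, so that a building over the empty index set is
  a single chamber. Panels may be infinite, hence no \<open>card\<close> in \<open>two_in_panel\<close>.\<close>

locale right_angled_building = right_angled_coxeter_matrix I M
  for I :: "'i set" and M :: "'i \<Rightarrow> 'i \<Rightarrow> enat" +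
  fixes C :: "'c set" and adj :: "'i \<Rightarrow> ('c \<times> 'c) set" and \<delta> :: "'c \<Rightarrow> 'c \<Rightarrow> 'i list set"
  assumes nonempty: "C \<noteq> {}"
    and equiv_adj: "i \<in> I \<Longrightarrow> equiv C (adj i)"
    and two_in_panel: "i \<in> I \<Longrightarrow> P \<in> C // adj i \<Longrightarrow> \<exists>c\<in>P. \<exists>d\<in>P. c \<noteq> d"
    and delta_closed: "c \<in> C \<Longrightarrow> d \<in> C \<Longrightarrow> \<delta> c d \<in> carrier (coxeter_group I M)"
    and delta_iff_gallery: "c \<in> C \<Longrightarrow> d \<in> C \<Longrightarrow> reduced_word I M w \<Longrightarrow>
      \<delta> c d = word_elem I M w \<longleftrightarrow> gallery adj c w d"

text \<open>The parameters \<open>q\<^sub>i\<close> are arbitrary cardinals, given as the cardinalities of sets \<open>Q i\<close>.\<close>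

definition semiregular ::
  "'i set \<Rightarrow> 'c set \<Rightarrow> ('i \<Rightarrow> ('c \<times> 'c) set) \<Rightarrow> ('i \<Rightarrow> 'q set) \<Rightarrow> bool" where
  "semiregular I C adj Q \<longleftrightarrow> (\<forall>i\<in>I. \<forall>P \<in> C // adj i. P \<approx> Q i)"

definition chamber_dist ::
  "'i set \<Rightarrow> ('i \<Rightarrow> ('c \<times> 'c) set) \<Rightarrow> 'c \<Rightarrow> 'c \<Rightarrow> nat" where
  "chamber_dist I adj c d = (LEAST n. \<exists>w \<in> lists I. length w = n \<and> gallery adj c w d)"

definition legal_colouring ::
  "'i set \<Rightarrow> 'c set \<Rightarrow> ('i \<Rightarrow> ('c \<times> 'c) set) \<Rightarrow> ('i \<Rightarrow> 'x set) \<Rightarrow> ('i \<Rightarrow> 'c \<Rightarrow> 'x) \<Rightarrow> bool" where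
  "legal_colouring I C adj X col \<longleftrightarrow>
     (\<forall>i\<in>I. \<forall>c\<in>C. col i c \<in> X i) \<and>
     (\<forall>i\<in>I. \<forall>P \<in> C // adj i.
        bij_betw (col i) P (X i) \<and>
        (\<forall>j\<in>I. j \<noteq> i \<longrightarrow> (\<forall>c\<in>P. \<forall>d\<in>P. col j c = col j d)))"

end

theory Submission
  imports Defs
begin

text \<open>
  The map \<open>\<tau>\<close> is obtained by following galleries. Fix a chamber \<open>c0\<close> of \<open>\<Delta>\<close> and a chamber
  \<open>d0\<close> of \<open>\<Delta>'\<close> whose \<open>i\<close>-colour is the class of the \<open>i\<close>-colour of \<open>c0\<close> for every \<open>i \<in> I'\<close>.
  While a chamber moves along a gallery in \<open>\<Delta>\<close>, a second chamber moves in \<open>\<Delta>'\<close>: at a step of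
  type \<open>i \<in> I'\<close> it goes to the chamber of its \<open>i\<close>-panel that has the required colour, and at a
  step of type outside \<open>I'\<close> it stays. The point is that the final position of the second chamber
  depends only on the final position of the first.

  To see this, let \<open>P\<close> be the set of pairs of chambers with matching colours and call two pairs
  \<open>i\<close>-adjacent if they differ by a step as above. Because a legal colouring is bijective on
  panels, the projection \<open>P \<rightarrow> \<Delta>\<close> lifts every adjacency uniquely, and because types that
  commute in \<open>W\<close> also commute in the Coxeter group of \<open>\<Delta>'\<close>, squares in \<open>\<Delta>\<close> lift to squares
  in \<open>P\<close>. So \<open>P \<rightarrow> \<Delta>\<close> behaves like a covering, and buildings are simply connected: a path
  in \<open>P\<close> lying over a closed gallery of \<open>\<Delta>\<close> is closed (\<open>covering_injective\<close>). The graph of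
  \<open>\<tau>\<close> is the connected component of \<open>(c0, d0)\<close> in \<open>P\<close>. Surjectivity follows by lifting galleries
  of \<open>\<Delta>'\<close> step by step, and the distance estimate because \<open>\<tau>\<close> sends galleries to paths that are
  not longer.

  Simple connectedness rests on the solution of the word problem in \<open>W\<close>: a word that is not reduced
  contains two equal letters separated only by letters commuting with them
  (\<open>irreducible_imp_reduced\<close>, \<open>reducible_split\<close>). A path over a closed gallery of positive
  length therefore has a type of this form, and by moving one of the two letters across squares next
  to the other and merging the two steps it can be shortened without changing its end points.
\<close>

section \<open>The word problem in right-angled Coxeter groups\<close>

context right_angled_coxeter_matrix
begin

text \<open>
  A word up to commutations is recorded by its restrictions to the sets of pairwise
  non-commuting letters, on which the order of the letters cannot change. This avoids quotients:
  words that differ by commutations have literally the same record.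
\<close>

definition cliques :: "'i set set" where
  "cliques = {A. A \<subseteq> I \<and> (\<forall>a\<in>A. \<forall>b\<in>A. M a b \<noteq> 2)}"

text \<open>For \<open>f = proj w\<close> this says that commutations can bring a letter \<open>i\<close> of \<open>w\<close> to the front.\<close>

definition leading :: "'i \<Rightarrow> ('i set \<Rightarrow> 'i list) \<Rightarrow> bool" where
  "leading i f \<longleftrightarrow> (\<forall>A\<in>cliques. i \<in> A \<longrightarrow> (\<exists>xs. f A = i # xs))"

definition proj :: "'i list \<Rightarrow> 'i set \<Rightarrow> 'i list" where
  "proj w A = (if A \<in> cliques then filter (\<lambda>x. x \<in> A) w else [])"

text \<open>
  Left multiplication by the generator \<open>i\<close> on records: cancel a letter \<open>i\<close> at the front if
  there is one, and put one there otherwise.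
\<close>

definition toggle :: "'i \<Rightarrow> ('i set \<Rightarrow> 'i list) \<Rightarrow> 'i set \<Rightarrow> 'i list" where
  "toggle i f = (\<lambda>A. if i \<in> A \<and> A \<in> cliques
     then (if leading i f then tl (f A) else i # f A) else f A)"

text \<open>No letter can be cancelled against a later equal letter after commutations.\<close>

primrec irreducible_word :: "'i list \<Rightarrow> bool" where
  "irreducible_word [] \<longleftrightarrow> True"
| "irreducible_word (i # w) \<longleftrightarrow> \<not> leading i (proj w) \<and> irreducible_word w"

lemma diag_ne_2: "i \<in> I \<Longrightarrow> M i i \<noteq> 2"
  by (simp add: diag)

lemma singleton_clique: "i \<in> I \<Longrightarrow> {i} \<in> cliques"
  by (simp add: cliques_def diag_ne_2)

lemma proj_commuting:
  "\<forall>j\<in>set b. M i j = 2 \<Longrightarrow> i \<in> A \<Longrightarrow> proj b A = []"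
  by (auto simp: proj_def cliques_def filter_empty_conv)

lemma proj_Nil: "proj [] A = []"
  by (simp add: proj_def)

lemma proj_append: "proj (u @ v) A = proj u A @ proj v A"
  by (simp add: proj_def)

text \<open>
  The split is at the first \<open>i\<close>, which exists because of the clique \<open>{i}\<close>. An earlier letter
  \<open>j\<close> not commuting with \<open>i\<close> would come first in the restriction of the word to \<open>{i, j}\<close>.
\<close>

lemma leading_split:
  assumes "leading i (proj w)" "w \<in> lists I" "i \<in> I"
  obtains b c where "w = b @ i # c" "\<forall>j\<in>set b. M i j = 2"
proof -
  obtain xs where "proj w {i} = i # xs"
    using assms singleton_clique by (auto simp: leading_def)
  then have "i \<in> set (proj w {i})" by simp
  then have "i \<in> set w" by (auto simp: proj_def split: if_splits)
  then obtain b c where w: "w = b @ i # c" "i \<notin> set b"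
    by (metis split_list_first)
  have "M i j = 2" if j: "j \<in> set b" for j
  proof (rule ccontr)
    assume ne: "M i j \<noteq> 2"
    have "j \<in> I" using j w assms by auto
    then have clique: "{i, j} \<in> cliques"
      using ne assms symm[of i j] by (auto simp: cliques_def diag_ne_2)
    then obtain ys where ys: "proj b {i, j} @ proj (i # c) {i, j} = i # ys"
      using clique assms w by (auto simp: leading_def simp flip: proj_append)
    have "j \<in> set (proj b {i, j})" "i \<notin> set (proj b {i, j})"
      using j w clique by (auto simp: proj_def)
    then show False using ys by (cases "proj b {i, j}") auto
  qed
  then show ?thesis using w that by blast
qed

lemma leading_append:
  assumes "\<forall>j\<in>set b. M i j = 2"
  shows "leading i (proj (b @ c)) \<longleftrightarrow> leading i (proj c)"
  using proj_commuting[OF assms] by (simp add: leading_def proj_append)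

lemma leading_Cons: "leading i (proj (i # c))"
  by (simp add: leading_def proj_def)

lemma leading_delete:
  assumes "i \<in> I" "k \<in> I" "M i k = 2"
  shows "leading k (proj (b @ i # c)) \<longleftrightarrow> leading k (proj (b @ c))"
proof -
  have "proj (b @ i # c) A = proj (b @ c) A" if "A \<in> cliques" "k \<in> A" for A
    using that assms by (auto simp: proj_def cliques_def)
  then show ?thesis by (simp add: leading_def)
qed

lemma irreducible_suffix: "irreducible_word (u @ v) \<Longrightarrow> irreducible_word v"
  by (induction u) auto

text \<open>
  A letter \<open>k\<close> before the deleted \<open>i\<close> commutes with it, hence no clique contains both, and what is
  leading for \<open>k\<close> is not affected by the deletion.
\<close>

lemma irreducible_delete:
  assumes "irreducible_word (b @ i # c)" "\<forall>j\<in>set b. M i j = 2" "b @ i # c \<in> lists I"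
  shows "irreducible_word (b @ c)"
  using assms by (induction b) (auto simp: leading_delete)

lemma toggle_leading:
  assumes "\<forall>j\<in>set b. M i j = 2"
  shows "toggle i (proj (b @ i # c)) = proj (b @ c)"
proof
  fix A
  have "leading i (proj (b @ i # c))"
    using assms by (simp add: leading_append leading_Cons)
  then show "toggle i (proj (b @ i # c)) A = proj (b @ c) A"
    using proj_commuting[OF assms, of A]
    by (auto simp: toggle_def proj_append) (auto simp: proj_def)
qed

lemma toggle_not_leading:
  "\<not> leading i (proj w) \<Longrightarrow> toggle i (proj w) = proj (i # w)"
  by (auto simp: toggle_def proj_def)

text \<open>
  The word has to be irreducible: if its record had two cancellable letters \<open>i\<close> in front, toggling
  twice would remove both.
\<close>

lemma toggle_toggle:
  assumes "irreducible_word w" "w \<in> lists I" "i \<in> I"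
  shows "toggle i (toggle i (proj w)) = proj w"
proof (cases "leading i (proj w)")
  case True
  then obtain b c where w: "w = b @ i # c" "\<forall>j\<in>set b. M i j = 2"
    using leading_split assms by blast
  \<comment> \<open>Since \<open>b\<close> commutes with \<open>i\<close>, a second cancellable \<open>i\<close> would have to come from \<open>c\<close>.\<close>
  have "\<not> leading i (proj c)"
    using irreducible_suffix[of b "i # c"] assms w by simp
  then have "\<not> leading i (proj (b @ c))"
    using w by (simp add: leading_append)
  then have "toggle i (toggle i (proj w)) = proj (i # b @ c)"
    using w by (simp add: toggle_leading toggle_not_leading)
  also have "\<dots> = proj w"
  proof
    fix A
    show "proj (i # b @ c) A = proj w A"
      using proj_commuting[OF w(2), of A] w(1)
      by (cases "A \<in> cliques"; cases "i \<in> A") (auto simp: proj_def)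
  qed
  finally show ?thesis .
next
  case False
  then show ?thesis
    using toggle_leading[of "[]" i w] by (simp add: toggle_not_leading)
qed

text \<open>
  Commuting letters lie in no common clique, so the two operations act on disjoint sets of
  components.
\<close>

lemma toggle_commute:
  assumes "M i j = 2" "i \<in> I" "j \<in> I"
  shows "toggle i (toggle j f) = toggle j (toggle i f)"
proof -
  have disj: "\<not> (i \<in> A \<and> j \<in> A)" if "A \<in> cliques" for A
    using that assms by (auto simp: cliques_def)
  have l: "leading i (toggle j f) \<longleftrightarrow> leading i f" "leading j (toggle i f) \<longleftrightarrow> leading j f"
    using disj by (auto simp: leading_def toggle_def)
  show ?thesis
  proof
    fix A
    show "toggle i (toggle j f) A = toggle j (toggle i f) A"
      unfolding toggle_def[of i "toggle j f"] toggle_def[of j "toggle i f"] l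
      using disj[of A] by (auto simp: toggle_def)
  qed
qed

definition irreducible_states :: "('i set \<Rightarrow> 'i list) set" where
  "irreducible_states = proj ` {w \<in> lists I. irreducible_word w}"

lemma toggle_states:
  assumes "f \<in> irreducible_states" "i \<in> I"
  shows "toggle i f \<in> irreducible_states"
proof -
  obtain w where w: "w \<in> lists I" "irreducible_word w" "f = proj w"
    using assms by (auto simp: irreducible_states_def)
  show ?thesis
  proof (cases "leading i f")
    case True
    then obtain b c where bc: "w = b @ i # c" "\<forall>j\<in>set b. M i j = 2"
      using leading_split assms w by blast
    then have "irreducible_word (b @ c)" "b @ c \<in> lists I"
      using irreducible_delete w by auto
    then show ?thesis
      using bc w by (auto simp: toggle_leading irreducible_states_def)
  next
    case False
    then have "irreducible_word (i # w)" "i # w \<in> lists I"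
      using w assms by auto
    then show ?thesis
      using False w by (auto simp: toggle_not_leading irreducible_states_def simp del: irreducible_word.simps)
  qed
qed

lemma foldr_toggle_states:
  "w \<in> lists I \<Longrightarrow> f \<in> irreducible_states \<Longrightarrow> foldr toggle w f \<in> irreducible_states"
  by (induction w) (auto simp: toggle_states)

text \<open>
  The involutions satisfy the defining relations, so the Coxeter group acts on the records of
  irreducible words.
\<close>

lemma foldr_toggle_cong:
  assumes "coxeter_cong I M u v" "f \<in> irreducible_states"
  shows "foldr toggle u f = foldr toggle v f"
  using assms
proof (induction arbitrary: f rule: coxeter_cong.induct)
  case (relator u v i j k)
  define g where "g = foldr toggle v f"
  have g: "g \<in> irreducible_states"
    using relator foldr_toggle_states by (simp add: g_def)
  have inv: "toggle a (toggle a h) = h" if "h \<in> irreducible_states" "a \<in> I" for a h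
    using that toggle_toggle by (auto simp: irreducible_states_def)
  have "foldr toggle (concat (replicate k [i, j])) g = g"
  proof (cases "i = j")
    case True
    then have "k = 1" using relator diag by (simp add: one_enat_def)
    then show ?thesis using True inv g relator by simp
  next
    case False
    then have m: "M i j = 2" using right_angled relator by fastforce
    then have "k = Suc (Suc 0)" using relator by (simp add: numeral_eq_enat)
    moreover have "toggle i (toggle j (toggle i (toggle j g))) = g"
      using toggle_commute[OF m relator(3,4), of g] relator(3,4) inv g by (simp add: toggle_states)
    ultimately show ?thesis by simp
  qed
  then show ?case by (simp add: g_def)
qed auto

lemma foldr_toggle_irreducible:
  "irreducible_word w \<Longrightarrow> foldr toggle w (proj []) = proj w"
  by (induction w) (auto simp: toggle_not_leading)

lemma length_eq_sum_proj:
  "w \<in> lists I \<Longrightarrow> length w = (\<Sum>i\<in>I. length (proj w {i}))"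
proof (induction w)
  case (Cons a w)
  have "(\<Sum>i\<in>I. length (proj (a # w) {i})) = (\<Sum>i\<in>I. (if i = a then 1 else 0) + length (proj w {i}))"
    using singleton_clique by (intro sum.cong) (auto simp: proj_def)
  then show ?case
    using Cons finite_index by (simp add: sum.distrib)
qed (simp add: proj_Nil)

lemma foldr_toggle_short:
  assumes "w \<in> lists I"
  shows "\<exists>v\<in>lists I. foldr toggle w (proj []) = proj v \<and> length v \<le> length w"
  using assms
proof (induction w)
  case (Cons i w)
  then obtain v where v: "v \<in> lists I" "foldr toggle w (proj []) = proj v" "length v \<le> length w"
    by auto
  show ?case
  proof (cases "leading i (proj v)")
    case True
    have "i \<in> I" using Cons by simp
    then obtain b c where "v = b @ i # c" "\<forall>j\<in>set b. M i j = 2"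
      using leading_split[OF True v(1)] by blast
    then show ?thesis
      using v by (intro bexI[of _ "b @ c"]) (auto simp: toggle_leading)
  next
    case False
    then show ?thesis
      using v Cons by (intro bexI[of _ "i # v"]) (auto simp: toggle_not_leading)
  qed
qed auto

text \<open>
  Applying a word \<open>v\<close> to the empty record gives the record of a word no longer than \<open>v\<close>; applying
  the irreducible \<open>w\<close> gives the record of \<open>w\<close> itself. If both words represent the same group
  element the two records agree, and the record determines the length.
\<close>

theorem irreducible_imp_reduced:
  assumes "irreducible_word w" "w \<in> lists I"
  shows "reduced_word I M w"
  unfolding reduced_word_def
proof (intro conjI ballI impI)
  fix v assume v: "v \<in> lists I" "word_elem I M v = word_elem I M w"
  have "proj [] \<in> irreducible_states"
    by (auto simp: irreducible_states_def)
  then have "foldr toggle v (proj []) = proj w"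
    using v foldr_toggle_cong foldr_toggle_irreducible[OF assms(1)]
    by (metis word_elem_eq_iff)
  then obtain u where u: "u \<in> lists I" "proj w = proj u" "length u \<le> length v"
    using foldr_toggle_short v by metis
  then have "length w = length u"
    using assms by (simp add: length_eq_sum_proj)
  then show "length w \<le> length v" using u by simp
qed (use assms in simp)

lemma reducible_split:
  assumes "\<not> irreducible_word w" "w \<in> lists I"
  obtains a i b c where "w = a @ i # b @ i # c" "\<forall>j\<in>set b. M i j = 2"
proof -
  have "\<exists>a i b c. w = a @ i # b @ i # c \<and> (\<forall>j\<in>set b. M i j = 2)"
    using assms
  proof (induction w)
    case (Cons k w)
    show ?case
    proof (cases "irreducible_word w")
      case True
      then have "leading k (proj w)" "w \<in> lists I" "k \<in> I" using Cons.prems by auto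
      then obtain b c where "w = b @ k # c" "\<forall>j\<in>set b. M k j = 2"
        using leading_split by blast
      then show ?thesis
        by (metis append_Nil)
    next
      case False
      then obtain a i b c where "w = a @ i # b @ i # c" "\<forall>j\<in>set b. M i j = 2"
        using Cons by auto
      then show ?thesis by (metis append_Cons)
    qed
  qed simp
  then show ?thesis using that by blast
qed

lemma word_elem_commute:
  assumes "i \<in> I" "j \<in> I" "M i j = 2"
  shows "word_elem I M [i, j] = word_elem I M [j, i]"
proof -
  have 1: "coxeter_cong I M (u @ [a, a] @ v) (u @ v)" if "u \<in> lists I" "v \<in> lists I" "a \<in> I" for u v a
    using coxeter_cong.relator[OF that(1,2,3,3), of M 1] diag[OF that(3)]
    by (simp add: one_enat_def)
  \<comment> \<open>\<open>ijijji\<close> reduces to \<open>ji\<close> from the left and to \<open>ij\<close> from the right.\<close>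
  have "coxeter_cong I M ([] @ concat (replicate 2 [i, j]) @ [j, i]) ([] @ [j, i])"
    using assms by (intro coxeter_cong.relator) (auto simp: numeral_eq_enat)
  then have "coxeter_cong I M [i, j, i, j, j, i] [j, i]"
    by (simp add: numeral_2_eq_2)
  moreover have "coxeter_cong I M [i, j, i, j, j, i] [i, j, i, i]"
    using 1[of "[i, j, i]" "[i]" j] assms by simp
  moreover have "coxeter_cong I M [i, j, i, i] [i, j]"
    using 1[of "[i, j]" "[]" i] assms by simp
  ultimately have "coxeter_cong I M [i, j] [j, i]"
    by (meson coxeter_cong.sym coxeter_cong.trans)
  then show ?thesis using assms by (subst word_elem_eq_iff) auto
qed

end

section \<open>Lifting galleries through coverings of a building\<close>

text \<open>
  Unlike in \<open>gallery\<close>, consecutive vertices may coincide. Paths then compose as relations, and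
  neither the merging of two adjacent steps nor the image under a non-injective map has to
  distinguish cases.
\<close>

primrec paths :: "('i \<Rightarrow> ('p \<times> 'p) set) \<Rightarrow> 'i list \<Rightarrow> ('p \<times> 'p) set" where
  "paths A [] = Id"
| "paths A (i # w) = A i O paths A w"

lemma paths_append: "paths A (u @ v) = paths A u O paths A v"
  by (induction u) auto

lemma paths_move_front:
  assumes "\<And>j. j \<in> set b \<Longrightarrow> A j O A i \<subseteq> A i O A j"
  shows "paths A b O A i \<subseteq> A i O paths A b"
  using assms
proof (induction b)
  case (Cons j b)
  have "paths A (j # b) O A i = A j O (paths A b O A i)" by (simp add: O_assoc)
  also have "\<dots> \<subseteq> A j O (A i O paths A b)"
    using Cons by (intro relcomp_mono[OF order_refl]) simp
  also have "\<dots> = (A j O A i) O paths A b" by (simp add: O_assoc)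
  also have "\<dots> \<subseteq> (A i O A j) O paths A b" using Cons.prems by (intro relcomp_mono[OF _ order_refl]) simp
  finally show ?case by (simp add: O_assoc)
qed simp

lemma rtrancl_imp_paths:
  assumes "(x, y) \<in> (\<Union>i\<in>I. A i)\<^sup>*"
  shows "\<exists>w\<in>lists I. (x, y) \<in> paths A w"
  using assms
proof (induction rule: converse_rtrancl_induct)
  case base
  then show ?case by (intro bexI[of _ "[]"]) auto
next
  case (step u v)
  then obtain i w where "i \<in> I" "(u, v) \<in> A i" "w \<in> lists I" "(v, y) \<in> paths A w" by auto
  then show ?case by (intro bexI[of _ "i # w"]) auto
qed

lemma gallery_imp_rtrancl:
  "gallery A c w d \<Longrightarrow> w \<in> lists I \<Longrightarrow> (c, d) \<in> (\<Union>i\<in>I. A i)\<^sup>*"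
  by (induction w arbitrary: c) (auto intro: converse_rtrancl_into_rtrancl)

text \<open>A step that projects to a constant step is itself constant and can be left out.\<close>

lemma gallery_or_shorter_path:
  assumes "(x, y) \<in> paths A w"
    and "\<And>i x y. i \<in> set w \<Longrightarrow> (x, y) \<in> A i \<Longrightarrow> (p x, p y) \<in> B i"
    and "\<And>i x y. i \<in> set w \<Longrightarrow> (x, y) \<in> A i \<Longrightarrow> p x = p y \<Longrightarrow> x = y"
  shows "gallery B (p x) w (p y) \<or>
    (\<exists>v. set v \<subseteq> set w \<and> length v < length w \<and> (x, y) \<in> paths A v)"
  using assms
proof (induction w arbitrary: x)
  case (Cons i w)
  then obtain z where z: "(x, z) \<in> A i" "(z, y) \<in> paths A w" by auto
  consider "gallery B (p z) w (p y)"
    | v where "set v \<subseteq> set w" "length v < length w" "(z, y) \<in> paths A v"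
    using Cons.IH[OF z(2)] Cons.prems by (metis list.set_intros(2))
  then show ?case
  proof cases
    case 1
    show ?thesis
    proof (cases "p x = p z")
      case True
      then have "x = z" using z Cons.prems(3)[of i x z] by simp
      then show ?thesis using z by auto
    next
      case False
      then show ?thesis using 1 z Cons.prems(2)[of i x z] by auto
    qed
  next
    case 2
    then show ?thesis using z by (intro disjI2 exI[of _ "i # v"]) auto
  qed
qed simp

lemma path_to_gallery:
  assumes "(c, d) \<in> paths B w"
  shows "\<exists>v. set v \<subseteq> set w \<and> length v \<le> length w \<and> gallery B c v d"
  using assms
proof (induction w arbitrary: c)
  case (Cons i w)
  then obtain e v where "(c, e) \<in> B i" "set v \<subseteq> set w" "length v \<le> length w" "gallery B e v d"
    by fastforce
  then show ?case
    by (cases "c = e") (force intro: exI[of _ v] exI[of _ "i # v"])+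
qed simp

context right_angled_building
begin

lemma adj_refl: "i \<in> I \<Longrightarrow> c \<in> C \<Longrightarrow> (c, c) \<in> adj i"
  using equiv_adj by (auto simp: equiv_def refl_on_def)

lemma adj_sym: "i \<in> I \<Longrightarrow> (c, d) \<in> adj i \<Longrightarrow> (d, c) \<in> adj i"
  using equiv_adj by (auto simp: equiv_def sym_def)

lemma adj_trans: "i \<in> I \<Longrightarrow> (c, d) \<in> adj i \<Longrightarrow> (d, e) \<in> adj i \<Longrightarrow> (c, e) \<in> adj i"
  using equiv_adj by (meson equiv_def transD)

lemma adj_in_C: "i \<in> I \<Longrightarrow> (c, d) \<in> adj i \<Longrightarrow> c \<in> C \<and> d \<in> C"
  using equiv_adj by (fastforce simp: equiv_def refl_on_def)

text \<open>
  If the two steps are proper, they form a gallery of reduced type \<open>[i, j]\<close>. As \<open>[j, i]\<close> is a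
  reduced word for the same group element, there is also a gallery of type \<open>[j, i]\<close>.
\<close>

lemma panel_square:
  assumes "i \<in> I" "j \<in> I" "M i j = 2"
  shows "adj i O adj j \<subseteq> adj j O adj i"
proof clarify
  fix c e d assume ce: "(c, e) \<in> adj i" and ed: "(e, d) \<in> adj j"
  have C: "c \<in> C" "e \<in> C" "d \<in> C" using adj_in_C assms ce ed by blast+
  have ij: "i \<noteq> j" using assms diag_ne_2 by auto
  have red: "reduced_word I M [a, b]" if "a \<in> I" "b \<in> I" "a \<noteq> b" for a b
    using that singleton_clique
    by (intro irreducible_imp_reduced) (auto simp: leading_def proj_def split: if_splits)
  show "(c, d) \<in> adj j O adj i"
  proof (cases "c = e \<or> e = d")
    case True
    then show ?thesis using ce ed C adj_refl assms by auto
  next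
    case False
    then have "gallery adj c [i, j] d" using ce ed by auto
    then have "gallery adj c [j, i] d"
      using delta_iff_gallery[OF C(1,3) red] ij assms word_elem_commute by metis
    then show ?thesis by auto
  qed
qed

lemma chambers_connected:
  assumes "c \<in> C" "d \<in> C"
  shows "\<exists>w\<in>lists I. gallery adj c w d"
proof -
  obtain v where v: "v \<in> lists I" "\<delta> c d = word_elem I M v"
    using delta_closed[OF assms] by (auto simp: coxeter_group_def)
  obtain w where w: "w \<in> lists I \<and> word_elem I M w = word_elem I M v"
    "\<And>u. u \<in> lists I \<and> word_elem I M u = word_elem I M v \<Longrightarrow> length w \<le> length u"
    using ex_has_least_nat[of "\<lambda>w. w \<in> lists I \<and> word_elem I M w = word_elem I M v" v length] v
    by blast
  then have "reduced_word I M w" by (auto simp: reduced_word_def)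
  then show ?thesis using delta_iff_gallery[OF assms] v w by metis
qed

lemma closed_reduced_gallery:
  assumes "c \<in> C" "reduced_word I M w" "gallery adj c w c"
  shows "w = []"
proof -
  have "reduced_word I M []" by (simp add: reduced_word_def)
  then have "word_elem I M [] = word_elem I M w"
    using delta_iff_gallery assms by (metis gallery.simps(1))
  then have "length w \<le> length ([] :: 'i list)"
    using assms(2) unfolding reduced_word_def by blast
  then show ?thesis by simp
qed

text \<open>
  Simple connectedness of the building: \<open>p\<close> is a covering of the chamber system, in the sense that it
  is injective on panels and squares can be completed upstairs, and a path over a closed gallery is
  closed. The path is shortened until nothing is left. If its type is irreducible, hence
  reduced, and its image is a proper gallery, then the type is empty since \<open>\<delta> c c = 1\<close>;
  otherwise either a constant step can be dropped, or two equal letters of the type can be moved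
  together and merged.
\<close>

theorem covering_injective:
  assumes hom: "\<And>i x y. i \<in> I \<Longrightarrow> (x, y) \<in> A i \<Longrightarrow> (p x, p y) \<in> adj i"
    and inj: "\<And>i x y. i \<in> I \<Longrightarrow> (x, y) \<in> A i \<Longrightarrow> p x = p y \<Longrightarrow> x = y"
    and trans: "\<And>i. i \<in> I \<Longrightarrow> A i O A i \<subseteq> A i"
    and square: "\<And>i j. i \<in> I \<Longrightarrow> j \<in> I \<Longrightarrow> M i j = 2 \<Longrightarrow> A i O A j \<subseteq> A j O A i"
    and xy: "(x, y) \<in> paths A w" "w \<in> lists I" "p x = p y" "p x \<in> C"
  shows "x = y"
  using xy
proof (induction "length w" arbitrary: w rule: less_induct)
  case less
  show ?case
  proof (cases "irreducible_word w")
    case True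
    have "gallery adj (p x) w (p y) \<or>
      (\<exists>v. set v \<subseteq> set w \<and> length v < length w \<and> (x, y) \<in> paths A v)"
    proof (rule gallery_or_shorter_path[OF less.prems(1)])
      show "(p a, p b) \<in> adj i" if "i \<in> set w" "(a, b) \<in> A i" for i a b
        using that less.prems hom by blast
      show "a = b" if "i \<in> set w" "(a, b) \<in> A i" "p a = p b" for i a b
        using that less.prems inj by blast
    qed
    then show ?thesis
    proof
      assume "gallery adj (p x) w (p y)"
      then have "w = []"
        using closed_reduced_gallery irreducible_imp_reduced True less.prems by metis
      then show ?thesis using less.prems by simp
    next
      assume "\<exists>v. set v \<subseteq> set w \<and> length v < length w \<and> (x, y) \<in> paths A v"
      then show ?thesis using less by blast
    qed
  next
    case False
    then obtain a i b c where w: "w = a @ i # b @ i # c" "\<forall>j\<in>set b. M i j = 2"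
      using reducible_split less.prems by blast
    have mem: "i \<in> I" "\<And>j. j \<in> set b \<Longrightarrow> j \<in> I" using w less.prems by auto
    have "paths A b O A i \<subseteq> A i O paths A b"
    proof (rule paths_move_front)
      fix j assume "j \<in> set b"
      then show "A j O A i \<subseteq> A i O A j"
        using square mem w(2) symm by metis
    qed
    then have "paths A (i # b @ [i]) \<subseteq> A i O (A i O paths A b)"
      by (simp add: paths_append relcomp_mono)
    also have "\<dots> = (A i O A i) O paths A b"
      by (simp add: O_assoc)
    also have "\<dots> \<subseteq> paths A (i # b)"
      using trans[OF mem(1)] by (simp add: relcomp_mono)
    finally have "paths A a O paths A (i # b @ [i]) O paths A c
        \<subseteq> paths A a O paths A (i # b) O paths A c"
      by (intro relcomp_mono order_refl)
    then have "(x, y) \<in> paths A (a @ i # b @ c)"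
      using less.prems(1) w by (simp add: paths_append O_assoc subset_iff)
    then show ?thesis
      using less.hyps[of "a @ i # b @ c"] less.prems w by auto
  qed
qed

end


section \<open>Coloured buildings\<close>

locale coloured_building = right_angled_building I M C adj \<delta>
  for I :: "'i set" and M :: "'i \<Rightarrow> 'i \<Rightarrow> enat"
    and C :: "'c set" and adj :: "'i \<Rightarrow> ('c \<times> 'c) set" and \<delta> :: "'c \<Rightarrow> 'c \<Rightarrow> 'i list set" +
  fixes X :: "'i \<Rightarrow> 'x set" and col :: "'i \<Rightarrow> 'c \<Rightarrow> 'x"
  assumes legal: "legal_colouring I C adj X col"
begin

lemma col_in: "i \<in> I \<Longrightarrow> c \<in> C \<Longrightarrow> col i c \<in> X i"
  using legal by (auto simp: legal_colouring_def)

lemma panel: "i \<in> I \<Longrightarrow> c \<in> C \<Longrightarrow> adj i `` {c} \<in> C // adj i"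
  by (simp add: quotientI)

lemma panel_bij: "i \<in> I \<Longrightarrow> c \<in> C \<Longrightarrow> bij_betw (col i) (adj i `` {c}) (X i)"
  using legal panel by (auto simp: legal_colouring_def)

lemma recolour:
  assumes "i \<in> I" "c \<in> C" "x \<in> X i"
  shows "\<exists>d. (c, d) \<in> adj i \<and> col i d = x"
proof -
  have "x \<in> col i ` (adj i `` {c})"
    using panel_bij[OF assms(1,2)] assms(3) by (simp add: bij_betw_def)
  then show ?thesis by auto
qed

lemma col_other:
  assumes "i \<in> I" "j \<in> I" "j \<noteq> i" "(c, d) \<in> adj i"
  shows "col j d = col j c"
proof -
  have "c \<in> C" using adj_in_C assms by blast
  then have "\<forall>a\<in>adj i `` {c}. \<forall>b\<in>adj i `` {c}. col j a = col j b"
    using legal panel[OF assms(1)] assms(1-3) unfolding legal_colouring_def by blast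
  moreover have "c \<in> adj i `` {c}" "d \<in> adj i `` {c}"
    using adj_refl[OF assms(1) \<open>c \<in> C\<close>] assms(4) by auto
  ultimately show ?thesis by metis
qed

lemma col_inj:
  assumes "i \<in> I" "(c, d) \<in> adj i" "(c, e) \<in> adj i" "col i d = col i e"
  shows "d = e"
proof -
  have "c \<in> C" using adj_in_C assms by blast
  then show ?thesis
    using panel_bij[OF assms(1)] assms by (auto simp: bij_betw_def inj_on_def)
qed

text \<open>
  The colours are corrected one type at a time: moving within an \<open>i\<close>-panel changes only the
  \<open>i\<close>-colour.
\<close>

lemma chamber_with_colours:
  assumes "\<And>i. i \<in> I \<Longrightarrow> x i \<in> X i"
  shows "\<exists>c\<in>C. \<forall>i\<in>I. col i c = x i"
proof -
  have "\<exists>c\<in>C. \<forall>i\<in>J. col i c = x i" if "J \<subseteq> I" for J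
    using finite_subset[OF that finite_index] that
  proof (induction J rule: finite_induct)
    case empty
    then show ?case using nonempty by auto
  next
    case (insert j J)
    then obtain c where c: "c \<in> C" "\<forall>i\<in>J. col i c = x i" by auto
    then obtain d where d: "(c, d) \<in> adj j" "col j d = x j"
      using recolour[of j c "x j"] insert.prems assms by auto
    have "col i d = x i" if "i \<in> J" for i
      using that c d insert.hyps insert.prems col_other[of j i c d] by auto
    moreover have "d \<in> C"
      using adj_in_C[OF _ d(1)] insert.prems by simp
    ultimately show ?case
      using d(2) by blast
  qed
  then show ?thesis by blast
qed

end

section \<open>The fibre product of two coloured buildings\<close>

text \<open>
  The quotient maps \<open>X i \<rightarrow> X i // R i\<close> are replaced by arbitrary surjections \<open>\<phi> i\<close>, defined
  for the types \<open>i \<in> I'\<close> whose colours are kept.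
\<close>

locale recoloured_buildings =
  B: coloured_building I M C adj \<delta> X col +
  B': coloured_building I' M' C' adj' \<delta>' Y col'
  for I :: "'i set" and M :: "'i \<Rightarrow> 'i \<Rightarrow> enat"
    and C :: "'c set" and adj :: "'i \<Rightarrow> ('c \<times> 'c) set" and \<delta> :: "'c \<Rightarrow> 'c \<Rightarrow> 'i list set"
    and X :: "'i \<Rightarrow> 'x set" and col :: "'i \<Rightarrow> 'c \<Rightarrow> 'x"
    and I' :: "'i set" and M' :: "'i \<Rightarrow> 'i \<Rightarrow> enat"
    and C' :: "'d set" and adj' :: "'i \<Rightarrow> ('d \<times> 'd) set" and \<delta>' :: "'d \<Rightarrow> 'd \<Rightarrow> 'i list set"
    and Y :: "'i \<Rightarrow> 'y set" and col' :: "'i \<Rightarrow> 'd \<Rightarrow> 'y" +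
  fixes \<phi> :: "'i \<Rightarrow> 'x \<Rightarrow> 'y"
  assumes subset: "I' \<subseteq> I"
    and commuting: "i \<in> I' \<Longrightarrow> j \<in> I' \<Longrightarrow> M i j = 2 \<Longrightarrow> M' i j = 2"
    and surj: "i \<in> I' \<Longrightarrow> \<phi> i ` X i = Y i"
begin

definition compatible :: "('c \<times> 'd) set" where
  "compatible = {(c, d). c \<in> C \<and> d \<in> C' \<and> (\<forall>i\<in>I'. col' i d = \<phi> i (col i c))}"

text \<open>What an \<open>i\<close>-adjacency of \<open>\<Delta>\<close> becomes in \<open>\<Delta>'\<close>: forgotten types do not move the chamber.\<close>

definition weak_adj :: "'i \<Rightarrow> ('d \<times> 'd) set" where
  "weak_adj i = (if i \<in> I' then adj' i else Id)"

text \<open>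
  Compatibility of both pairs forces the second component to make the move prescribed by the
  first, as a chamber of a panel is determined by its colour.
\<close>

definition lift_adj :: "'i \<Rightarrow> (('c \<times> 'd) \<times> ('c \<times> 'd)) set" where
  "lift_adj i = {((c, d), (e, f)). (c, d) \<in> compatible \<and> (e, f) \<in> compatible \<and>
     (c, e) \<in> adj i \<and> (d, f) \<in> weak_adj i}"

lemma weak_adj_in_C: "(d, f) \<in> weak_adj i \<Longrightarrow> d \<in> C' \<Longrightarrow> f \<in> C'"
  using B'.adj_in_C by (auto simp: weak_adj_def split: if_splits)

lemma weak_adj_col: "(d, f) \<in> weak_adj i \<Longrightarrow> j \<in> I' \<Longrightarrow> j \<noteq> i \<Longrightarrow> col' j f = col' j d"
  using B'.col_other[of i j d f] by (auto simp: weak_adj_def split: if_splits)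

lemma lift_adj_compatible: "(p, q) \<in> lift_adj i \<Longrightarrow> q \<in> compatible"
  by (auto simp: lift_adj_def)

lemma lift_adj_sym: "i \<in> I \<Longrightarrow> (p, q) \<in> lift_adj i \<Longrightarrow> (q, p) \<in> lift_adj i"
  using B.adj_sym[of i] B'.adj_sym[of i]
  by (auto simp: lift_adj_def weak_adj_def split: if_splits)

lemma lift_adj_trans: "i \<in> I \<Longrightarrow> lift_adj i O lift_adj i \<subseteq> lift_adj i"
  using B.adj_trans[of i] B'.adj_trans[of i]
  by (fastforce simp: lift_adj_def weak_adj_def split: if_splits)

lemma lift_adj_unique:
  assumes "i \<in> I" "(p, q) \<in> lift_adj i" "(p, r) \<in> lift_adj i" "fst q = fst r"
  shows "q = r"
  using assms B'.col_inj[of i "snd p" "snd q" "snd r"]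
  by (auto simp: lift_adj_def weak_adj_def compatible_def split: if_splits)

lemma lift_adj_refl: "i \<in> I \<Longrightarrow> p \<in> compatible \<Longrightarrow> (p, p) \<in> lift_adj i"
  by (auto simp: lift_adj_def weak_adj_def compatible_def intro: B.adj_refl B'.adj_refl)

lemma lift_adj_exists:
  assumes "i \<in> I" "(c, d) \<in> compatible" "(c, e) \<in> adj i"
  shows "\<exists>f. ((c, d), (e, f)) \<in> lift_adj i"
proof -
  have C: "c \<in> C" "d \<in> C'" "e \<in> C"
    using assms B.adj_in_C by (auto simp: compatible_def)
  have other: "col j e = col j c" if "j \<in> I'" "j \<noteq> i" for j
    using that B.col_other assms subset by blast
  show ?thesis
  proof (cases "i \<in> I'")
    case True
    then have "\<phi> i (col i e) \<in> Y i"
      using surj B.col_in C assms by blast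
    then obtain f where f: "(d, f) \<in> adj' i" "col' i f = \<phi> i (col i e)"
      using B'.recolour True C by blast
    have "col' j f = \<phi> j (col j e)" if "j \<in> I'" for j
      using that other[of j] f B'.col_other[OF True that] assms
      by (cases "j = i") (auto simp: compatible_def)
    then have "(e, f) \<in> compatible"
      using C f B'.adj_in_C[OF True] by (auto simp: compatible_def)
    then show ?thesis
      using f True assms by (auto simp: lift_adj_def weak_adj_def)
  next
    case False
    have "col j e = col j c" if "j \<in> I'" for j
      using other[OF that] False that by blast
    then have "(e, d) \<in> compatible"
      using assms(2) C by (auto simp: compatible_def)
    then show ?thesis
      using False assms by (auto simp: lift_adj_def weak_adj_def)
  qed
qed

lemma weak_adj_square:
  assumes "i \<in> I" "j \<in> I" "M i j = 2"
  shows "weak_adj i O weak_adj j \<subseteq> weak_adj j O weak_adj i"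
  using B'.panel_square[of i j] commuting[of i j] assms by (auto simp: weak_adj_def)

text \<open>
  The square is completed separately in the two components. The new corner is compatible since its
  \<open>i\<close>-colours are those of the initial pair and its other colours those of the final pair.
\<close>

lemma lift_adj_square:
  assumes ij: "i \<in> I" "j \<in> I" "M i j = 2"
  shows "lift_adj i O lift_adj j \<subseteq> lift_adj j O lift_adj i"
proof clarify
  fix c d e f g h
  assume 1: "((c, d), (e, f)) \<in> lift_adj i" and 2: "((e, f), (g, h)) \<in> lift_adj j"
  have ne: "i \<noteq> j" using ij B.diag_ne_2 by auto
  obtain e' where e': "(c, e') \<in> adj j" "(e', g) \<in> adj i"
    using B.panel_square[OF ij] 1 2 by (auto simp: lift_adj_def)
  obtain f' where f': "(d, f') \<in> weak_adj j" "(f', h) \<in> weak_adj i"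
    using weak_adj_square[OF ij] 1 2 by (auto simp: lift_adj_def)
  have d: "(c, d) \<in> compatible" "(g, h) \<in> compatible"
    using 1 2 by (auto simp: lift_adj_def)
  have "col' k f' = \<phi> k (col k e')" if k: "k \<in> I'" for k
  proof (cases "k = i")
    case True
    then have "col k e' = col k c" "col' k f' = col' k d"
      using B.col_other[OF ij(2) _ _ e'(1)] weak_adj_col[OF f'(1)] ne k subset by auto
    then show ?thesis using d k by (auto simp: compatible_def)
  next
    case False
    then have "col k g = col k e'" "col' k h = col' k f'"
      using B.col_other[OF ij(1) _ _ e'(2)] weak_adj_col[OF f'(2)] k subset by auto
    then show ?thesis using d k by (auto simp: compatible_def)
  qed
  then have "(e', f') \<in> compatible"
    using d e' f' B.adj_in_C[OF ij(2)] weak_adj_in_C by (auto simp: compatible_def)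
  then show "((c, d), (g, h)) \<in> lift_adj j O lift_adj i"
    using e' f' d by (auto simp: lift_adj_def)
qed

lemma lift_unique:
  assumes "(p, q) \<in> (\<Union>i\<in>I. lift_adj i)\<^sup>*" "fst p = fst q" "p \<in> compatible"
  shows "p = q"
proof -
  obtain w where w: "w \<in> lists I" "(p, q) \<in> paths lift_adj w"
    using rtrancl_imp_paths[OF assms(1)] by blast
  show ?thesis
  proof (rule B.covering_injective[where A = lift_adj and p = fst and w = w])
    show "lift_adj i O lift_adj i \<subseteq> lift_adj i" if "i \<in> I" for i
      using that by (rule lift_adj_trans)
    show "lift_adj i O lift_adj j \<subseteq> lift_adj j O lift_adj i"
      if "i \<in> I" "j \<in> I" "M i j = 2" for i j
      using that by (rule lift_adj_square)
    show "x = y" if "i \<in> I" "(x, y) \<in> lift_adj i" "fst x = fst y" for i x y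
      using lift_adj_unique[OF that(1) lift_adj_refl that(2)] that
      by (auto simp: lift_adj_def)
  qed (use assms w in \<open>auto simp: lift_adj_def compatible_def\<close>)
qed

lemma lift_exists:
  assumes "(c, e) \<in> (\<Union>i\<in>I. adj i)\<^sup>*" "(c, d) \<in> compatible"
  shows "\<exists>f. ((c, d), (e, f)) \<in> (\<Union>i\<in>I. lift_adj i)\<^sup>* \<and> (e, f) \<in> compatible"
  using assms(1)
proof (induction rule: rtrancl_induct)
  case base
  then show ?case using assms by auto
next
  case (step e e')
  then obtain f i where f: "((c, d), (e, f)) \<in> (\<Union>i\<in>I. lift_adj i)\<^sup>*" "(e, f) \<in> compatible"
      "i \<in> I" "(e, e') \<in> adj i" by auto
  then obtain f' where f': "((e, f), (e', f')) \<in> lift_adj i"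
    using lift_adj_exists by blast
  then have "((e, f), (e', f')) \<in> (\<Union>i\<in>I. lift_adj i)" using f by blast
  then show ?case
    using f(1) f' by (meson rtrancl_into_rtrancl lift_adj_compatible)
qed

text \<open>The graph of \<open>\<tau>\<close> is the connected component of a compatible pair \<open>(c0, d0)\<close>.\<close>

lemma adjacency_preserving_map_exists:
  obtains \<tau> where
    "\<And>c. c \<in> C \<Longrightarrow> (c, \<tau> c) \<in> compatible"
    "\<And>i c e. i \<in> I \<Longrightarrow> (c, e) \<in> adj i \<Longrightarrow> (\<tau> c, \<tau> e) \<in> weak_adj i"
proof -
  let ?E = "(\<Union>i\<in>I. lift_adj i)\<^sup>*"
  obtain c0 where c0: "c0 \<in> C" using B.nonempty by auto
  have "\<exists>d\<in>C'. \<forall>i\<in>I'. col' i d = \<phi> i (col i c0)"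
    using surj B.col_in[OF _ c0] subset by (intro B'.chamber_with_colours) blast
  then obtain d0 where d0: "(c0, d0) \<in> compatible"
    using c0 by (auto simp: compatible_def)
  have "sym ?E"
    by (intro sym_rtrancl) (auto simp: sym_def dest: lift_adj_sym)
  have "\<exists>d. ((c0, d0), (c, d)) \<in> ?E \<and> (c, d) \<in> compatible" if "c \<in> C" for c
    using B.chambers_connected[OF c0 that] gallery_imp_rtrancl lift_exists d0 by metis
  then obtain \<tau> where \<tau>: "((c0, d0), (c, \<tau> c)) \<in> ?E" "(c, \<tau> c) \<in> compatible" if "c \<in> C" for c
    by metis
  show ?thesis
  proof (rule that)
    fix i c e assume i: "i \<in> I" and ce: "(c, e) \<in> adj i"
    have C: "c \<in> C" "e \<in> C" using B.adj_in_C i ce by auto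
    obtain f where f: "((c, \<tau> c), (e, f)) \<in> lift_adj i"
      using lift_adj_exists i ce \<tau>(2) C by blast
    then have "((c0, d0), (e, f)) \<in> ?E"
      using \<tau>(1)[OF C(1)] i by (meson UN_I rtrancl_into_rtrancl)
    \<comment> \<open>Both pairs lie over \<open>e\<close> in the component of \<open>(c0, d0)\<close>.\<close>
    then have "((e, \<tau> e), (e, f)) \<in> ?E"
      using \<tau>(1)[OF C(2)] \<open>sym ?E\<close> by (meson rtrancl_trans symD)
    then have "f = \<tau> e"
      using lift_unique[of "(e, \<tau> e)" "(e, f)"] \<tau>(2) C by auto
    then show "(\<tau> c, \<tau> e) \<in> weak_adj i"
      using f by (auto simp: lift_adj_def)
  qed (use \<tau> in auto)
qed

text \<open>
  The image is closed under adjacency in \<open>\<Delta>'\<close>: to reach a neighbour of \<open>\<tau> c\<close> of colour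
  \<open>\<phi> i x\<close>, recolour \<open>c\<close> to \<open>x\<close> within its \<open>i\<close>-panel.
\<close>

lemma adjacency_preserving_map_surj:
  assumes comp: "\<And>c. c \<in> C \<Longrightarrow> (c, \<tau> c) \<in> compatible"
    and adj: "\<And>i c e. i \<in> I \<Longrightarrow> (c, e) \<in> adj i \<Longrightarrow> (\<tau> c, \<tau> e) \<in> weak_adj i"
  shows "\<tau> ` C = C'"
proof
  show "\<tau> ` C \<subseteq> C'" using comp by (auto simp: compatible_def)
  obtain c0 where c0: "c0 \<in> C" using B.nonempty by auto
  have "d \<in> \<tau> ` C" if "(\<tau> c0, d) \<in> (\<Union>i\<in>I'. adj' i)\<^sup>*" for d
    using that
  proof (induction rule: rtrancl_induct)
    case (step d e)
    then obtain c i where c: "c \<in> C" "d = \<tau> c" and i: "i \<in> I'" and de: "(d, e) \<in> adj' i" by auto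
    have "col' i e \<in> Y i"
      using B'.col_in[OF i] B'.adj_in_C[OF i de] by blast
    then obtain x where x: "x \<in> X i" "\<phi> i x = col' i e"
      using surj[OF i] by (metis imageE)
    then obtain c' where c': "(c, c') \<in> adj i" "col i c' = x"
      using B.recolour c i subset by blast
    then have "c' \<in> C" using B.adj_in_C i subset by blast
    then have "col' i (\<tau> c') = col' i e"
      using comp i x c' by (auto simp: compatible_def)
    moreover have "(d, \<tau> c') \<in> adj' i"
      using adj[OF _ c'(1)] i subset c by (auto simp: weak_adj_def)
    ultimately have "\<tau> c' = e"
      using B'.col_inj i de by blast
    then show ?case using \<open>c' \<in> C\<close> by blast
  qed (use c0 in auto)
  moreover have "\<tau> c0 \<in> C'" using comp c0 by (auto simp: compatible_def)
  ultimately show "C' \<subseteq> \<tau> ` C"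
    using B'.chambers_connected gallery_imp_rtrancl by (metis subsetI)
qed

lemma gallery_image_path:
  assumes "gallery adj c w e" "w \<in> lists I"
    and adj: "\<And>i c e. i \<in> I \<Longrightarrow> (c, e) \<in> adj i \<Longrightarrow> (\<tau> c, \<tau> e) \<in> weak_adj i"
  shows "(\<tau> c, \<tau> e) \<in> paths adj' (filter (\<lambda>i. i \<in> I') w)"
  using assms(1,2)
proof (induction w arbitrary: c)
  case (Cons i w)
  then obtain d where d: "(c, d) \<in> adj i" "gallery adj d w e" by auto
  then have "(\<tau> c, \<tau> d) \<in> weak_adj i" using adj Cons.prems by auto
  then show ?case using Cons.IH[OF d(2)] Cons.prems by (auto simp: weak_adj_def)
qed simp

lemma chamber_dist_image_le:
  assumes adj: "\<And>i c e. i \<in> I \<Longrightarrow> (c, e) \<in> adj i \<Longrightarrow> (\<tau> c, \<tau> e) \<in> weak_adj i"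
    and c: "c \<in> C" "e \<in> C"
  shows "chamber_dist I' adj' (\<tau> c) (\<tau> e) \<le> chamber_dist I adj c e"
proof -
  have "\<exists>n. \<exists>w\<in>lists I. length w = n \<and> gallery adj c w e"
    using B.chambers_connected[OF c] by blast
  from LeastI_ex[OF this]
  obtain w where w: "w \<in> lists I" "length w = chamber_dist I adj c e" "gallery adj c w e"
    unfolding chamber_dist_def by blast
  have "(\<tau> c, \<tau> e) \<in> paths adj' (filter (\<lambda>i. i \<in> I') w)"
    using w(3,1) adj by (rule gallery_image_path)
  then obtain v where v: "set v \<subseteq> set (filter (\<lambda>i. i \<in> I') w)"
      "length v \<le> length (filter (\<lambda>i. i \<in> I') w)" "gallery adj' (\<tau> c) v (\<tau> e)"
    using path_to_gallery by metis
  then have "v \<in> lists I'" by auto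
  then have "chamber_dist I' adj' (\<tau> c) (\<tau> e) \<le> length v"
    unfolding chamber_dist_def by (intro Least_le bexI[of _ v] conjI HOL.refl v(3))
  also have "\<dots> \<le> length w"
    using v(2) length_filter_le le_trans by blast
  finally show ?thesis using w by simp
qed

end

section \<open>Quotients of the colour sets\<close>

theorem proposition5p1:
  fixes I I' :: "'i set"
    and M M' :: "'i \<Rightarrow> 'i \<Rightarrow> enat"
    and C :: "'c set" and adj :: "'i \<Rightarrow> ('c \<times> 'c) set" and \<delta> :: "'c \<Rightarrow> 'c \<Rightarrow> 'i list set"
    and C' :: "'d set" and adj' :: "'i \<Rightarrow> ('d \<times> 'd) set" and \<delta>' :: "'d \<Rightarrow> 'd \<Rightarrow> 'i list set"
    and X :: "'i \<Rightarrow> 'x set" and R :: "'i \<Rightarrow> ('x \<times> 'x) set"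
    and col :: "'i \<Rightarrow> 'c \<Rightarrow> 'x" and col' :: "'i \<Rightarrow> 'd \<Rightarrow> 'x set"
  assumes "right_angled_building I M C adj \<delta>"
    and "semiregular I C adj X"
    and "legal_colouring I C adj X col"
    and "\<And>i. i \<in> I \<Longrightarrow> equiv (X i) (R i)"
    and "I' = {i \<in> I. R i \<noteq> X i \<times> X i}"
    and "right_angled_building I' M' C' adj' \<delta>'"
    and "coxeter_diagram I' M' = coxeter_diagram I M \<inter> I' \<times> I'"
    and "semiregular I' C' adj' (\<lambda>i. X i // R i)"
    and "legal_colouring I' C' adj' (\<lambda>i. X i // R i) col'"
  shows "\<exists>\<tau>. \<tau> ` C = C' \<and>
    (\<forall>c\<in>C. \<forall>i\<in>I'. col' i (\<tau> c) = R i `` {col i c}) \<and>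
    (\<forall>c1\<in>C. \<forall>c2\<in>C. chamber_dist I' adj' (\<tau> c1) (\<tau> c2) \<le> chamber_dist I adj c1 c2)"
proof -
  interpret B: coloured_building I M C adj \<delta> X col
    using assms by (simp add: coloured_building_def coloured_building_axioms_def)
  interpret B': coloured_building I' M' C' adj' \<delta>' "\<lambda>i. X i // R i" col'
    using assms by (simp add: coloured_building_def coloured_building_axioms_def)
  interpret recoloured_buildings I M C adj \<delta> X col I' M' C' adj' \<delta>' "\<lambda>i. X i // R i" col'
    "\<lambda>i x. R i `` {x}"
  proof
    show "I' \<subseteq> I" using assms(5) by blast
    show "(\<lambda>x. R i `` {x}) ` X i = X i // R i" for i
      by (auto simp: quotient_def)
    fix i j assume ij: "i \<in> I'" "j \<in> I'" "M i j = 2"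
    then have "i \<noteq> j" using B.diag_ne_2 \<open>I' \<subseteq> I\<close> by blast
    moreover from this have "M' i j \<in> {2, \<infinity>}"
      using B'.right_angled ij by blast
    moreover have "(i, j) \<notin> coxeter_diagram I' M'"
      using ij(3) unfolding assms(7) by (simp add: coxeter_diagram_def)
    ultimately show "M' i j = 2"
      using ij(1,2) unfolding coxeter_diagram_def by blast
  qed
  obtain \<tau> where \<tau>: "\<And>c. c \<in> C \<Longrightarrow> (c, \<tau> c) \<in> compatible"
    "\<And>i c e. i \<in> I \<Longrightarrow> (c, e) \<in> adj i \<Longrightarrow> (\<tau> c, \<tau> e) \<in> weak_adj i"
    using adjacency_preserving_map_exists by blast
  show ?thesis
  proof (intro exI[of _ \<tau>] conjI ballI)
    show "\<tau> ` C = C'" using adjacency_preserving_map_surj \<tau> by blast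
    show "col' i (\<tau> c) = R i `` {col i c}" if "c \<in> C" "i \<in> I'" for c i
      using \<tau>(1)[OF that(1)] that by (auto simp: compatible_def)
    show "chamber_dist I' adj' (\<tau> c1) (\<tau> c2) \<le> chamber_dist I adj c1 c2"
      if "c1 \<in> C" "c2 \<in> C" for c1 c2
      using chamber_dist_image_le[of \<tau>] \<tau>(2) that by blast
  qed
qed

end
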